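(* Let $G$ be a factorizable graph such that the poset $(\mathcal{G}(G), \triangleleft)$ has a minimum element $G_0$. Then $V(G_0)$ is exactly the set of vertices that do not belong to $C(G-x)$ for any $x\in V(G)$; that is, $$V(G_0) = V(G)\setminus \bigcup_{x\in V(G)} C(G-x).$$
   Context: Graphs are finite. A graph is factorizable if it has a perfect matching. An edge of a factorizable graph $G$ is allowed if some perfect matching of $G$ contains it. A connected component of the subgraph of $G$ determined by all allowed edges is an elementary component of $G$; for each elementary component $H$, the induced subgraph $G[V(H)]$ is called a factor-connected component of $G$. $\mathcal{G}(G)$ denotes the set of all factor-connected components of $G$; their vertex sets partition $V(G)$. A set $X\subseteq V(G)$ is separating if every $H\in\mathcal{G}(G)$ satisfies $V(H)\subseteq X$ or $V(H)\cap X=\emptyset$. A graph is factor-critical if deleting any one vertex leaves a factorizable graph (a one-vertex graph is regarded as factor-critical). $G[X]/Y$ denotes the graph obtained from $G[X]$ by contracting $Y$ to a single vertex. For $G_1,G_2\in\mathcal{G}(G)$, write $G_1\triangleleft G_2$ if there is a separating set $X\subseteq V(G)$ with $V(G_1)\cup V(G_2)\subseteq X$ such that $G[X]/V(G_1)$ is factor-critical. It is known that $\triangleleft$ is a partial order on $\mathcal{G}(G)$. Gallai-Edmonds partition: for any graph $F$, $D(F)$ is the set of vertices $v$ such that some maximum matching of $F$ exposes $v$ (contains no edge incident to $v$); $A(F)$ is the set of vertices in $V(F)\setminus D(F)$ adjacent to some vertex of $D(F)$; and $C(F)=V(F)\setminus(D(F)\cup A(F))$. *)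

theory Defs
  imports Main
begin

text \<open>Finite simple graphs. Loops and parallel edges affect neither the existence of matchings with
  a given set of covered vertices nor connectivity, so they are left out; accordingly,
  contraction discards loops and identifies parallel edges.\<close>

record 'a ugraph =
  verts :: "'a set"
  edges :: "'a set set"

definition finite_graph :: "'a ugraph \<Rightarrow> bool" where
  "finite_graph G \<longleftrightarrow> finite (verts G) \<and> (\<forall>e\<in>edges G. e \<subseteq> verts G \<and> card e = 2)"

definition adj :: "'a ugraph \<Rightarrow> 'a \<Rightarrow> 'a \<Rightarrow> bool" where
  "adj G u v \<longleftrightarrow> {u, v} \<in> edges G"

definition induced :: "'a ugraph \<Rightarrow> 'a set \<Rightarrow> 'a ugraph" where
  "induced G X = \<lparr>verts = verts G \<inter> X, edges = {e \<in> edges G. e \<subseteq> X}\<rparr>"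

definition delete_vert :: "'a ugraph \<Rightarrow> 'a \<Rightarrow> 'a ugraph" where
  "delete_vert G x = induced G (verts G - {x})"

text \<open>In the contraction, \<open>None\<close> is the vertex that \<open>Y\<close> is shrunk to. The condition
  \<open>card f = 2\<close> removes the loops arising from edges inside \<open>Y\<close>.\<close>

definition contract_map :: "'a set \<Rightarrow> 'a \<Rightarrow> 'a option" where
  "contract_map Y v = (if v \<in> Y then None else Some v)"

definition contract :: "'a ugraph \<Rightarrow> 'a set \<Rightarrow> 'a option ugraph" where
  "contract G Y =
     \<lparr>verts = contract_map Y ` verts G,
      edges = {f \<in> (\<lambda>e. contract_map Y ` e) ` edges G. card f = 2}\<rparr>"

definition connected_components :: "'a ugraph \<Rightarrow> 'a ugraph set" where
  "connected_components G = (\<lambda>v. induced G {u. (adj G)\<^sup>*\<^sup>* v u}) ` verts G"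

definition matching :: "'a ugraph \<Rightarrow> 'a set set \<Rightarrow> bool" where
  "matching G M \<longleftrightarrow> M \<subseteq> edges G \<and> pairwise disjnt M"

definition perfect_matching :: "'a ugraph \<Rightarrow> 'a set set \<Rightarrow> bool" where
  "perfect_matching G M \<longleftrightarrow> matching G M \<and> \<Union>M = verts G"

definition maximum_matching :: "'a ugraph \<Rightarrow> 'a set set \<Rightarrow> bool" where
  "maximum_matching G M \<longleftrightarrow> matching G M \<and> (\<forall>N. matching G N \<longrightarrow> card N \<le> card M)"

definition factorizable :: "'a ugraph \<Rightarrow> bool" where
  "factorizable G \<longleftrightarrow> (\<exists>M. perfect_matching G M)"

definition factor_critical :: "'a ugraph \<Rightarrow> bool" where
  "factor_critical G \<longleftrightarrow> (\<forall>v\<in>verts G. factorizable (delete_vert G v))"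

definition allowed_edges :: "'a ugraph \<Rightarrow> 'a set set" where
  "allowed_edges G = {e \<in> edges G. \<exists>M. perfect_matching G M \<and> e \<in> M}"

definition allowed_subgraph :: "'a ugraph \<Rightarrow> 'a ugraph" where
  "allowed_subgraph G = \<lparr>verts = \<Union>(allowed_edges G), edges = allowed_edges G\<rparr>"

definition elementary_components :: "'a ugraph \<Rightarrow> 'a ugraph set" where
  "elementary_components G = connected_components (allowed_subgraph G)"

definition factor_components :: "'a ugraph \<Rightarrow> 'a ugraph set" where
  "factor_components G = (\<lambda>H. induced G (verts H)) ` elementary_components G"

definition separating :: "'a ugraph \<Rightarrow> 'a set \<Rightarrow> bool" where
  "separating G X \<longleftrightarrow>
     X \<subseteq> verts G \<and> (\<forall>H\<in>factor_components G. verts H \<subseteq> X \<or> verts H \<inter> X = {})"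

text \<open>The relation \<open>\<triangleleft>\<close>; it is meant to be used on members of \<open>factor_components G\<close> only.\<close>

definition factor_le :: "'a ugraph \<Rightarrow> 'a ugraph \<Rightarrow> 'a ugraph \<Rightarrow> bool" where
  "factor_le G G1 G2 \<longleftrightarrow>
     (\<exists>X. separating G X \<and> verts G1 \<union> verts G2 \<subseteq> X \<and>
          factor_critical (contract (induced G X) (verts G1)))"

text \<open>The Gallai--Edmonds partition.\<close>

definition GE_D :: "'a ugraph \<Rightarrow> 'a set" where
  "GE_D F = {v \<in> verts F. \<exists>M. maximum_matching F M \<and> v \<notin> \<Union>M}"

definition GE_A :: "'a ugraph \<Rightarrow> 'a set" where
  "GE_A F = {v \<in> verts F - GE_D F. \<exists>u\<in>GE_D F. adj F v u}"

definition GE_C :: "'a ugraph \<Rightarrow> 'a set" where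
  "GE_C F = verts F - (GE_D F \<union> GE_A F)"

end

theory Submission
  imports Defs
begin

text \<open>A vertex \<open>y\<close> lies in \<open>D(G - x)\<close> iff \<open>G - x - y\<close> is factorizable. No edge of a perfect matching
  leaves \<open>C(G - x)\<close>, so within \<open>V(G\<^sub>0)\<close> every vertex is \<open>x\<close>, in \<open>D\<close> or in \<open>A\<close>; for \<open>x\<close> outside
  \<open>V(G\<^sub>0)\<close>, factor-criticality of the contraction supplies an alternating path from \<open>x\<close> into \<open>G\<^sub>0\<close>
  that reduces the claim to \<open>G\<^sub>0\<close>.

  Conversely, let \<open>v\<close> lie in a connected component \<open>K\<close> of \<open>G - V(G\<^sub>0)\<close>. On \<open>V(G\<^sub>0)\<close> call \<open>a\<close>, \<open>b\<close>
  equivalent if \<open>a = b\<close> or \<open>G - K - a - b\<close> is not factorizable (transitive, as in Kotzig's theorem).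
  If \<open>K + a + b\<close> has a perfect matching, then \<open>a\<close> and \<open>b\<close> are equivalent, as otherwise an edge
  leaving \<open>V(G\<^sub>0)\<close> would be allowed. Exchanging along the edges of \<open>K\<close> shows that all
  neighbours of \<open>K\<close> in \<open>V(G\<^sub>0)\<close> are equivalent. For a neighbour \<open>x\<close> of \<open>K\<close>, an alternating path from
  \<open>x\<close> that reaches \<open>K\<close> or one of its neighbours would contradict this, so \<open>v \<in> C(G - x)\<close>.
  Deleting all of \<open>K\<close> in this equivalence matters: the one defined inside \<open>G\<^sub>0\<close> alone is too
  coarse, since paths through other components can join vertices that it identifies.\<close>

section \<open>Perfect matchings of vertex subsets\<close>

text \<open>The edge set stays fixed while the vertex set varies, so that deleting vertices is a set
  difference and no subgraph has to be formed.\<close>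

definition covers_exactly :: "'a set set \<Rightarrow> 'a set \<Rightarrow> 'a set set \<Rightarrow> bool" where
  "covers_exactly E U M \<longleftrightarrow> M \<subseteq> E \<and> pairwise disjnt M \<and> \<Union>M = U"

definition matchable :: "'a set set \<Rightarrow> 'a set \<Rightarrow> bool" where
  "matchable E U \<longleftrightarrow> (\<exists>M. covers_exactly E U M)"

definition two_sets :: "'a set set \<Rightarrow> bool" where
  "two_sets E \<longleftrightarrow> (\<forall>e\<in>E. card e = 2)"

text \<open>Adjacency by allowed edges. For a factorizable graph the classes of its reflexive
  transitive closure are the vertex sets of the factor-connected components.\<close>

definition link :: "'a set set \<Rightarrow> 'a set \<Rightarrow> 'a \<Rightarrow> 'a \<Rightarrow> bool" where
  "link E U a b \<longleftrightarrow> (\<exists>M. covers_exactly E U M \<and> {a, b} \<in> M)"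

lemma two_setsE:
  assumes "two_sets E" "e \<in> E" "a \<in> e"
  obtains b where "b \<noteq> a" "e = {a, b}"
proof -
  obtain x y where "e = {x, y}" "x \<noteq> y" using assms unfolding two_sets_def card_2_iff by blast
  then show ?thesis using assms(3) that[of x] that[of y] by auto
qed

lemma covers_exactly_Un:
  assumes "covers_exactly E A M" "covers_exactly E B N" "A \<inter> B = {}"
  shows "covers_exactly E (A \<union> B) (M \<union> N)"
proof -
  have "disjnt e f" if "e \<in> M" "f \<in> N" for e f
    using assms that unfolding covers_exactly_def disjnt_def by blast
  then have "pairwise disjnt (M \<union> N)"
    using assms unfolding covers_exactly_def pairwise_def by (metis Un_iff disjnt_sym)
  then show ?thesis using assms unfolding covers_exactly_def by blast
qed

lemma matchable_Un:
  assumes "matchable E A" "matchable E B" "A \<inter> B = {}"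
  shows "matchable E (A \<union> B)"
  using assms covers_exactly_Un unfolding matchable_def by blast

lemma matchable_mono: "matchable E U \<Longrightarrow> E \<subseteq> F \<Longrightarrow> matchable F U"
  unfolding matchable_def covers_exactly_def by blast

lemma matchable_edge: "{a, b} \<in> E \<Longrightarrow> matchable E {a, b}"
  unfolding matchable_def covers_exactly_def by (rule exI[of _ "{{a, b}}"]) (simp add: pairwise_def)

lemma matchable_add_edge:
  assumes "matchable E A" "{a, b} \<in> E" "a \<in> B" "b \<in> B" "A = B - {a, b}"
  shows "matchable E B"
proof -
  have "matchable E (A \<union> {a, b})"
    by (rule matchable_Un[OF assms(1) matchable_edge[OF assms(2)]]) (use assms in blast)
  moreover have "A \<union> {a, b} = B" using assms by blast
  ultimately show ?thesis by simp
qed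

lemma covers_exactly_restrict:
  assumes "covers_exactly E U M" "\<And>e. e \<in> M \<Longrightarrow> e \<subseteq> K \<or> e \<inter> K = {}" "K \<subseteq> U"
  shows "covers_exactly E K {e \<in> M. e \<subseteq> K}"
proof -
  have "\<Union>{e \<in> M. e \<subseteq> K} = K" using assms unfolding covers_exactly_def by blast
  then show ?thesis using assms(1) unfolding covers_exactly_def pairwise_def by auto
qed

lemma covers_exactly_partner:
  assumes "two_sets E" "covers_exactly E U M" "a \<in> U"
  obtains b where "b \<in> U" "b \<noteq> a" "{a, b} \<in> M" "{a, b} \<in> E"
    "covers_exactly E (U - {a, b}) (M - {{a, b}})"
proof -
  obtain e where e: "e \<in> M" "a \<in> e" using assms unfolding covers_exactly_def by blast
  then have "e \<in> E" using assms unfolding covers_exactly_def by blast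
  then obtain b where b: "b \<noteq> a" "e = {a, b}" using two_setsE[OF assms(1) _ e(2)] by blast
  have "f \<inter> e = {}" if "f \<in> M" "f \<noteq> e" for f
    using assms(2) that e(1) unfolding covers_exactly_def pairwise_def disjnt_def by blast
  then have "\<Union>(M - {e}) = U - e" using assms(2) e(1) unfolding covers_exactly_def by blast
  then have "covers_exactly E (U - e) (M - {e})"
    using assms(2) unfolding covers_exactly_def pairwise_def by blast
  then show ?thesis using that[of b] b e \<open>e \<in> E\<close> assms(2) unfolding covers_exactly_def by blast
qed

lemma matchable_partner:
  assumes "two_sets E" "matchable E U" "a \<in> U"
  obtains b where "b \<in> U" "b \<noteq> a" "{a, b} \<in> E" "matchable E (U - {a, b})"
  using covers_exactly_partner[OF assms(1) _ assms(3)] assms(2) unfolding matchable_def by metis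

lemma card_covers_exactly:
  assumes "two_sets E" "covers_exactly E U M" "finite U"
  shows "card U = 2 * card M"
proof -
  have "card (\<Union>M) = sum card M"
  proof (rule card_Union_disjoint)
    show "pairwise disjnt M" using assms(2) unfolding covers_exactly_def by blast
    fix e assume "e \<in> M"
    then show "finite e"
      using assms unfolding covers_exactly_def by (meson Sup_upper finite_subset)
  qed
  also have "\<dots> = 2 * card M"
    using assms unfolding two_sets_def covers_exactly_def by (subst sum.cong[of _ _ _ "\<lambda>_. 2"]) auto
  finally show ?thesis using assms(2) unfolding covers_exactly_def by simp
qed

lemma matchable_even: "two_sets E \<Longrightarrow> matchable E U \<Longrightarrow> finite U \<Longrightarrow> even (card U)"
  using card_covers_exactly unfolding matchable_def by fastforce

section \<open>Alternating paths and exchange of matchings\<close>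

text \<open>The three cases are the possible ends \<open>a\<close>, \<open>c\<close>, \<open>d\<close> of the alternating path that starts in \<open>b\<close>.\<close>

lemma matching_exchange:
  assumes "two_sets E" "finite U"
    and "matchable E (U - {a, c})" "matchable E (U - {b, d})"
    and "{a, b, c, d} \<subseteq> U" "distinct [a, b, c, d]"
  shows "matchable E (U - {a, b}) \<or> matchable E (U - {b, c}) \<or>
    matchable E (U - {a, b, c, d}) \<and> matchable E U"
  using assms(2-)
proof (induction "card U" arbitrary: U b rule: less_induct)
  case less
  obtain p where p: "p \<in> U - {a, c}" "p \<noteq> b" "{b, p} \<in> E" "matchable E (U - {a, c} - {b, p})"
    using matchable_partner[OF assms(1) less.prems(2), of b] less.prems by auto
  show ?case
  proof (cases "p = d")
    \<comment> \<open>The path stops at \<open>d\<close>: the first matching without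
      \<open>{b, d}\<close> misses all four vertices, and the second one with \<open>{b, d}\<close>
      added covers \<open>U\<close>.\<close>
    case True
    have "U - {a, c} - {b, p} = U - {a, b, c, d}" using True by blast
    moreover have "matchable E U"
      by (rule matchable_add_edge[OF less.prems(3)]) (use less.prems p True in auto)
    ultimately show ?thesis using p by simp
  next
    case False
    obtain q where q: "q \<in> U - {b, d}" "q \<noteq> p" "{p, q} \<in> E" "matchable E (U - {b, d} - {p, q})"
      using matchable_partner[OF assms(1) less.prems(3), of p] p False by auto
    \<comment> \<open>Otherwise the path goes on from \<open>q\<close> inside
      \<open>U - {b, p}\<close>. Adding \<open>{p, q}\<close> turns a matching there that misses
      \<open>q\<close> into one of \<open>U\<close> that misses \<open>b\<close>.\<close>
    have move: "matchable E (U - {b} - S)"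
      if "matchable E (U - {b, p} - insert q S)" "p \<notin> S" "q \<notin> S" for S
    proof -
      show ?thesis
        by (rule matchable_add_edge[OF that(1) q(3)]) (use that p q in blast)+
    qed
    have pqU: "U - {a, c} - {b, p} = U - {b, p} - {a, c}"
      "U - {b, d} - {p, q} = U - {b, p} - {q, d}"
      "U - {a, b} = U - {b} - {a}" "U - {b, c} = U - {b} - {c}"
      "U - {a, b, c, d} = U - {b} - {a, c, d}"
      "U - {b, p} - {a, q} = U - {b, p} - insert q {a}"
      "U - {b, p} - {q, a} = U - {b, p} - insert q {a}"
      "U - {b, p} - {q, c} = U - {b, p} - insert q {c}"
      "U - {b, p} - {a, q, c, d} = U - {b, p} - insert q {a, c, d}"
      by blast+
    consider "q = a" | "q = c" | "q \<noteq> a" "q \<noteq> c" by blast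
    then show ?thesis
    proof cases
      case 1
      have "U - {a, c} - {b, p} = U - {b, p} - insert q {c}" using 1 by blast
      then show ?thesis using move[of "{c}"] 1 p less.prems pqU by auto
    next
      case 2
      have "U - {a, c} - {b, p} = U - {b, p} - insert q {a}" using 2 by blast
      then show ?thesis using move[of "{a}"] 2 p less.prems pqU by auto
    next
      case 3
      have "card (U - {b, p}) < card U"
        using less.prems p by (intro psubset_card_mono) auto
      then have "matchable E (U - {b, p} - {a, q}) \<or> matchable E (U - {b, p} - {q, c}) \<or>
          matchable E (U - {b, p} - {a, q, c, d}) \<and> matchable E (U - {b, p})"
        using less.prems p q False 3 pqU(1,2)
        by (intro less.hyps) auto
      then show ?thesis
      proof (elim disjE conjE)
        assume "matchable E (U - {b, p} - {a, q})"
        then show ?thesis using move[of "{a}"] p q 3 pqU by auto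
      next
        assume "matchable E (U - {b, p} - {q, c})"
        then show ?thesis using move[of "{c}"] p q 3 pqU by auto
      next
        assume h: "matchable E (U - {b, p} - {a, q, c, d})" "matchable E (U - {b, p})"
        have "matchable E U"
          by (rule matchable_add_edge[OF h(2) p(3)]) (use less.prems p in auto)
        then show ?thesis using move[of "{a, c, d}"] h p q 3 False pqU by auto
      qed
    qed
  qed
qed

text \<open>The alternating path from \<open>x\<close> to \<open>y\<close> is followed until it first meets \<open>K\<close>.\<close>

lemma matching_first_entry:
  assumes "two_sets E" "finite U"
    and "covers_exactly E U M" "\<And>e. e \<in> M \<Longrightarrow> e \<subseteq> K \<or> e \<inter> K = {}" "K \<subseteq> U"
    and "matchable E (U - {x, y})" "x \<in> U - K" "y \<in> U" "x \<noteq> y"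
  shows "y \<notin> K \<and> matchable E (U - K - {x, y}) \<or>
    (\<exists>u\<in>U - K. u \<noteq> x \<and> (\<exists>k\<in>K. {u, k} \<in> E) \<and> matchable E (U - K - {x, u}))"
  using assms(2-)
proof (induction "card U" arbitrary: U M x rule: less_induct)
  case less
  obtain p where p: "p \<in> U" "p \<noteq> x" "{x, p} \<in> M" "{x, p} \<in> E"
      "covers_exactly E (U - {x, p}) (M - {{x, p}})"
    using covers_exactly_partner[OF assms(1) less.prems(2), of x] less.prems by auto
  have pK: "p \<notin> K" using less.prems(3)[OF p(3)] less.prems by blast
  have "covers_exactly E (U - {x, p} - K) {e \<in> M - {{x, p}}. e \<subseteq> U - {x, p} - K}"
  proof (rule covers_exactly_restrict[OF p(5)])
    fix e assume "e \<in> M - {{x, p}}"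
    then show "e \<subseteq> U - {x, p} - K \<or> e \<inter> (U - {x, p} - K) = {}"
      using less.prems(3)[of e] p(5) unfolding covers_exactly_def by blast
  qed blast
  moreover have "U - {x, p} - K = U - K - {x, p}" by blast
  ultimately have mp: "matchable E (U - K - {x, p})" unfolding matchable_def by metis
  show ?case
  proof (cases "p = y")
    case True
    then show ?thesis using mp pK by blast
  next
    case False
    obtain q where q: "q \<in> U - {x, y}" "q \<noteq> p" "{p, q} \<in> E" "matchable E (U - {x, y} - {p, q})"
      using matchable_partner[OF assms(1) less.prems(5), of p] p False by auto
    show ?thesis
    proof (cases "q \<in> K")
      \<comment> \<open>The path enters \<open>K\<close> along \<open>{p, q}\<close>, so
        \<open>p\<close> is the required neighbour of \<open>K\<close>; \<open>M\<close> without
        \<open>{x, p}\<close>, restricted to the complement of \<open>K\<close>, is the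
        matching.\<close>
      case True
      then show ?thesis using mp p q pK by blast
    next
      case qK: False
      have move: "matchable E (U - K - {x, u})"
        if "matchable E (U - {x, p} - K - {q, u})" "u \<noteq> p" "u \<noteq> q" for u
        by (rule matchable_add_edge[OF that(1) q(3)]) (use that p q qK pK in blast)+
      have eq: "U - {x, y} - {p, q} = U - {x, p} - {q, y}" by blast
      have "y \<notin> K \<and> matchable E (U - {x, p} - K - {q, y}) \<or>
        (\<exists>u\<in>U - {x, p} - K. u \<noteq> q \<and> (\<exists>k\<in>K. {u, k} \<in> E) \<and> matchable E (U - {x, p} - K - {q, u}))"
      proof (rule less.hyps[OF _ _ p(5)])
        show "card (U - {x, p}) < card U"
          using less.prems p by (intro psubset_card_mono) auto
      qed (use less.prems p q qK pK False eq in auto)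
      then show ?thesis using move False q(1) by blast
    qed
  qed
qed

text \<open>In Gallai--Edmonds terms: \<open>C(U - w)\<close> is not left by any edge of a perfect matching of \<open>U\<close>, so
  it misses every vertex joined to \<open>w\<close> by allowed edges.\<close>

lemma reachable_not_GE_C:
  assumes "two_sets E" "finite U" "(link E U)\<^sup>*\<^sup>* w a" "a \<noteq> w" "w \<in> U"
  shows "matchable E (U - {w, a}) \<or> (\<exists>d\<in>U - {w, a}. {a, d} \<in> E \<and> matchable E (U - {w, d}))"
proof -
  define C where "C = {c \<in> U - {w}. \<not> matchable E (U - {w, c}) \<and>
    (\<forall>d\<in>U - {w, c}. {c, d} \<in> E \<longrightarrow> \<not> matchable E (U - {w, d}))}"
  have C_step: "y \<in> C" if c: "c \<in> C" and M: "covers_exactly E U M" "{c, y} \<in> M" for c y M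
  proof -
    obtain y' where y': "y' \<in> U" "y' \<noteq> c" "{c, y'} \<in> M" "{c, y'} \<in> E"
      "covers_exactly E (U - {c, y'}) (M - {{c, y'}})"
      using covers_exactly_partner[OF assms(1) M(1), of c] c unfolding C_def by blast
    have "{c, y'} = {c, y}"
    proof (rule ccontr)
      assume "{c, y'} \<noteq> {c, y}"
      moreover have "pairwise disjnt M" using M(1) unfolding covers_exactly_def by blast
      ultimately show False using pairwiseD[of disjnt M "{c, y'}" "{c, y}"] M(2) y'(3) by simp
    qed
    then have yy: "y' = y" using y'(2) by (auto simp: doubleton_eq_iff)
    note y = y'[unfolded yy]
    have my: "matchable E (U - {c, y})" using y(5) unfolding matchable_def by blast
    have yw: "y \<noteq> w"
      using my c unfolding C_def by (auto simp: insert_commute)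
    have nD: "\<not> matchable E (U - {w, y})" using c y yw unfolding C_def by blast
    have "\<not> matchable E (U - {w, d})" if d: "d \<in> U - {w, y}" "{y, d} \<in> E" for d
    proof
      assume md: "matchable E (U - {w, d})"
      have dc: "d \<noteq> c" "c \<noteq> w" using md c unfolding C_def by auto
      \<comment> \<open>The first outcome puts \<open>c\<close> into D(G - w), the second puts
        \<open>y\<close> there, and the third does so for \<open>c\<close> again once
        \<open>{y, d}\<close> is added. All three are excluded.\<close>
      have "matchable E (U - {c, w}) \<or> matchable E (U - {w, y}) \<or>
          matchable E (U - {c, w, y, d}) \<and> matchable E U"
        using assms c y d yw dc my md unfolding C_def
        by (intro matching_exchange) auto
      moreover have "matchable E (U - {w, c})" if h: "matchable E (U - {c, w, y, d})"
        by (rule matchable_add_edge[OF h d(2)]) (use d y yw dc in blast)+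
      ultimately show False using nD c unfolding C_def by (auto simp: insert_commute)
    qed
    then show ?thesis using nD y yw unfolding C_def by blast
  qed
  have "a \<notin> C \<and> a \<in> U" using assms(3)
  proof (induction rule: rtranclp_induct)
    case base
    then show ?case using assms(5) unfolding C_def by blast
  next
    case (step b c)
    obtain M where M: "covers_exactly E U M" "{b, c} \<in> M" using step unfolding link_def by blast
    then have "{c, b} \<in> M" by (simp add: insert_commute)
    moreover have "c \<in> U" using M unfolding covers_exactly_def by blast
    ultimately show ?case using C_step[of c M b] M step by blast
  qed
  then show ?thesis using assms(4) unfolding C_def by blast
qed

text \<open>If the conclusion fails, \<open>a\<close> is not in D(U - b), so by
  \<open>reachable_not_GE_C\<close> it has a neighbour \<open>d\<close> with
  \<open>U - {b, d}\<close> matchable. The only remaining outcome of the exchange misses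
  \<open>a\<close>, \<open>b\<close>, \<open>c\<close>, \<open>d\<close>; adding
  \<open>{a, d}\<close> leaves just \<open>b\<close> and \<open>c\<close> missed, a
  contradiction.\<close>

lemma kotzig_transitive:
  assumes "two_sets E" "finite U" "(link E U)\<^sup>*\<^sup>* b a" "{a, b, c} \<subseteq> U" "distinct [a, b, c]"
    and "matchable E (U - {a, c})"
  shows "matchable E (U - {a, b}) \<or> matchable E (U - {b, c})"
proof (rule ccontr)
  assume neg: "\<not> ?thesis"
  have "matchable E (U - {b, a}) \<or> (\<exists>d\<in>U - {b, a}. {a, d} \<in> E \<and> matchable E (U - {b, d}))"
    using assms by (intro reachable_not_GE_C) auto
  then obtain d where d: "d \<in> U - {b, a}" "{a, d} \<in> E" "matchable E (U - {b, d})"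
    using neg by (auto simp: insert_commute)
  have dc: "d \<noteq> c" using d neg by blast
  have "matchable E (U - {a, b}) \<or> matchable E (U - {b, c}) \<or>
      matchable E (U - {a, b, c, d}) \<and> matchable E U"
    using assms d dc by (intro matching_exchange) auto
  then have "matchable E (U - {a, b, c, d})" using neg by blast
  then have "matchable E (U - {b, c})"
    by (rule matchable_add_edge[OF _ d(2)]) (use assms d dc in auto)
  then show False using neg by blast
qed

section \<open>The minimum component in terms of matchings\<close>

text \<open>\<open>closed\<close> and \<open>connected\<close> express that \<open>V0\<close> is a
  factor-connected component. \<open>critical\<close> is what factor-criticality of the contractions
  gives: after \<open>x\<close> is deleted, the contracted vertex is matched to \<open>z\<close> by
  an edge coming from \<open>{w, z}\<close>.\<close>

locale factor_component_core =
  fixes E :: "'a set set" and V V0 :: "'a set"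
  assumes two_sets: "two_sets E" and finite_V: "finite V" and edges_subset: "e \<in> E \<Longrightarrow> e \<subseteq> V"
    and V0_subset: "V0 \<subseteq> V" and matchable_V: "matchable E V"
    and closed: "covers_exactly E V M \<Longrightarrow> e \<in> M \<Longrightarrow> e \<subseteq> V0 \<or> e \<inter> V0 = {}"
    and connected: "a \<in> V0 \<Longrightarrow> b \<in> V0 \<Longrightarrow> (link E V)\<^sup>*\<^sup>* a b"
    and critical: "x \<in> V - V0 \<Longrightarrow>
      \<exists>z w. z \<in> V - V0 \<and> z \<noteq> x \<and> w \<in> V0 \<and> {w, z} \<in> E \<and> matchable E (V - V0 - {x, z})"
begin

text \<open>No edge of a perfect matching of \<open>V\<close> crosses the boundary of
  \<open>U\<close>, so each such matching restricts to \<open>U\<close> and keeps the links inside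
  \<open>V0\<close>. It is applied to \<open>V0\<close> itself and to the complement of a component
  \<open>K\<close> of \<open>V - V0\<close>.\<close>

lemma link_restrict:
  assumes "V0 \<subseteq> U" "U \<subseteq> V" "\<And>M e. covers_exactly E V M \<Longrightarrow> e \<in> M \<Longrightarrow> e \<subseteq> U \<or> e \<inter> U = {}"
    and "a \<in> V0" "b \<in> V0"
  shows "(link E U)\<^sup>*\<^sup>* a b"
proof -
  have "b \<in> V0 \<and> (link E U)\<^sup>*\<^sup>* a b" using connected[OF assms(4,5)]
  proof (induction rule: rtranclp_induct)
    case base
    then show ?case using assms by blast
  next
    case (step b c)
    obtain M where M: "covers_exactly E V M" "{b, c} \<in> M" using step unfolding link_def by blast
    have c: "c \<in> V0" using closed[OF M] step by blast
    then have "link E U b c"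
      using covers_exactly_restrict[OF M(1) assms(3)[OF M(1)] assms(2)] M(2) step.IH assms(1)
      unfolding link_def by (intro exI[of _ "{e \<in> M. e \<subseteq> U}"]) auto
    then show ?case using step c by (meson rtranclp.rtrancl_into_rtrancl)
  qed
  then show ?thesis by blast
qed

lemma no_crossing:
  assumes "{a, b} \<in> E" "a \<in> V0" "b \<in> V - V0"
  shows "\<not> matchable E (V - {a, b})"
proof
  assume "matchable E (V - {a, b})"
  then obtain M where "covers_exactly E (V - {a, b}) M" unfolding matchable_def by blast
  moreover have "covers_exactly E {a, b} {{a, b}}"
    using assms unfolding covers_exactly_def by (simp add: pairwise_def)
  ultimately have "covers_exactly E (V - {a, b} \<union> {a, b}) (M \<union> {{a, b}})"
    by (rule covers_exactly_Un) blast
  moreover have "V - {a, b} \<union> {a, b} = V" using assms V0_subset by blast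
  ultimately show False using closed[of "M \<union> {{a, b}}" "{a, b}"] assms by auto
qed

lemma matchable_V0: "matchable E V0"
proof -
  obtain M where "covers_exactly E V M" using matchable_V unfolding matchable_def by blast
  then show ?thesis
    using covers_exactly_restrict[of E V M V0] closed[of M] V0_subset unfolding matchable_def by blast
qed

lemma V0_not_GE_C:
  assumes "v \<in> V0" "x \<in> V" "v \<noteq> x"
  shows "matchable E (V - {x, v}) \<or> (\<exists>d\<in>V - {x}. {v, d} \<in> E \<and> matchable E (V - {x, d}))"
proof (cases "x \<in> V0")
  case True
  then show ?thesis
    using reachable_not_GE_C[OF two_sets finite_V connected[OF True assms(1)]] assms by blast
next
  case False
  then obtain z w where zw: "z \<in> V - V0" "z \<noteq> x" "w \<in> V0" "{w, z} \<in> E"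
    "matchable E (V - V0 - {x, z})"
    using critical[of x] assms by blast
  \<comment> \<open>A matching of \<open>V0\<close> missing \<open>w\<close> and \<open>d\<close> is
    completed by \<open>{w, z}\<close> and the matching from \<open>critical\<close>, so that
    exactly \<open>x\<close> and \<open>d\<close> are missed.\<close>
  have extend: "matchable E (V - {x, d})" if d: "matchable E (V0 - {w, d})" "d \<in> V0" "d \<noteq> w" for d
  proof (rule matchable_add_edge[OF matchable_Un[OF d(1) zw(5)] zw(4)])
    show "V0 - {w, d} \<union> (V - V0 - {x, z}) = V - {x, d} - {w, z}"
      using d zw False assms V0_subset by blast
  qed (use d zw False V0_subset in blast)+
  show ?thesis
  proof (cases "v = w")
    \<comment> \<open>Here \<open>z\<close> itself is the neighbour in D(G - x): match
      \<open>V0\<close> within itself and drop the edge \<open>{w, z}\<close>.\<close>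
    case True
    have "matchable E (V0 \<union> (V - V0 - {x, z}))"
      by (rule matchable_Un[OF matchable_V0 zw(5)]) blast
    moreover have "V0 \<union> (V - V0 - {x, z}) = V - {x, z}" using zw False V0_subset by blast
    ultimately show ?thesis using zw True by auto
  next
    case vw: False
    have "(link E V0)\<^sup>*\<^sup>* w v" using V0_subset closed zw assms by (intro link_restrict) auto
    then have "matchable E (V0 - {w, v}) \<or>
        (\<exists>d\<in>V0 - {w, v}. {v, d} \<in> E \<and> matchable E (V0 - {w, d}))"
      using zw assms vw two_sets finite_subset[OF V0_subset finite_V]
      by (intro reachable_not_GE_C) auto
    then show ?thesis
    proof (elim disjE bexE conjE)
      assume "matchable E (V0 - {w, v})"
      then show ?thesis using extend assms vw by blast
    next
      fix d assume "d \<in> V0 - {w, v}" "{v, d} \<in> E" "matchable E (V0 - {w, d})"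
      then show ?thesis using extend[of d] V0_subset False by blast
    qed
  qed
qed

section \<open>Vertices outside the minimum component\<close>

lemma outside_GE_C:
  assumes v: "v \<in> V - V0"
  shows "\<exists>x\<in>V0. \<not> matchable E (V - {x, v}) \<and>
    (\<forall>d\<in>V - {x}. {v, d} \<in> E \<longrightarrow> \<not> matchable E (V - {x, d}))"
proof -
  define R where "R = (\<lambda>a b. a \<in> V - V0 \<and> b \<in> V - V0 \<and> {a, b} \<in> E)"
  define K where "K = {u. R\<^sup>*\<^sup>* v u}"
  have vK: "v \<in> K" unfolding K_def by simp
  have KB: "K \<subseteq> V - V0"
  proof
    fix u assume "u \<in> K"
    then have "R\<^sup>*\<^sup>* v u" unfolding K_def by blast
    then show "u \<in> V - V0" by (induction rule: rtranclp_induct) (use v R_def in auto)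
  qed
  have finK: "finite K" using KB finite_V by (meson finite_Diff finite_subset)
  have Kout: "b \<in> V0" if "a \<in> K" "{a, b} \<in> E" "b \<notin> K" for a b
  proof (rule ccontr)
    assume "b \<notin> V0"
    then have "R a b" using that KB edges_subset unfolding R_def by blast
    then show False using that unfolding K_def by (meson mem_Collect_eq rtranclp.rtrancl_into_rtrancl)
  qed
  have Kclosed: "e \<subseteq> K \<or> e \<inter> K = {}" if M: "covers_exactly E V M" "e \<in> M" for M e
  proof (rule ccontr)
    assume neg: "\<not> ?thesis"
    then obtain a where a: "a \<in> e" "a \<in> K" by blast
    have eE: "e \<in> E" using M unfolding covers_exactly_def by blast
    then obtain b where b: "e = {a, b}" using two_setsE[OF two_sets _ a(1)] by blast
    then have "b \<in> V0" using Kout[OF a(2)] eE neg a by blast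
    then show False using closed[OF M] b a KB by blast
  qed
  obtain M where M: "covers_exactly E V M" using matchable_V unfolding matchable_def by blast
  have "matchable E K"
    using covers_exactly_restrict[OF M Kclosed[OF M]] KB unfolding matchable_def by blast
  then have evenK: "even (card K)" using matchable_even two_sets finK by blast

  \<comment> \<open>Only edges meeting \<open>K\<close> are used, so that a matching of \<open>K \<union> {w, w'}\<close> cannot contain \<open>{w, w'}\<close>.\<close>
  define EK where "EK = {e \<in> E. e \<inter> K \<noteq> {}}"
  have EKE: "EK \<subseteq> E" unfolding EK_def by blast
  have twoEK: "two_sets EK" using two_sets unfolding two_sets_def EK_def by blast
  \<comment> \<open>The vertices of \<open>V0\<close> that can replace \<open>z\<close> in a perfect
    matching of \<open>K\<close>.\<close>
  define W where "W = (\<lambda>z. {w \<in> V0. matchable EK (insert w (K - {z}))})"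
  have Wne: "\<exists>w. w \<in> W z" if zK: "z \<in> K" for z
  proof -
    obtain y w where yw: "y \<in> V - V0" "y \<noteq> z" "w \<in> V0" "{w, y} \<in> E"
      "matchable E (V - V0 - {z, y})"
      using critical[of z] zK KB by blast
    have "matchable E (insert w (V - V0 - {z}))"
      by (rule matchable_add_edge[OF yw(5,4)]) (use yw in blast)+
    then obtain N where N: "covers_exactly E (insert w (V - V0 - {z})) N"
      unfolding matchable_def by blast
    define NK where "NK = {e \<in> N. e \<inter> K \<noteq> {}}"
    have "e \<subseteq> insert w (K - {z})" if eNK: "e \<in> NK" for e
    proof -
      have e: "e \<in> N" "e \<in> E" "e \<subseteq> insert w (V - V0 - {z})"
        using eNK N unfolding NK_def covers_exactly_def by blast+
      obtain a where a: "a \<in> e" "a \<in> K" using eNK unfolding NK_def by blast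
      obtain b where b: "e = {a, b}" using two_setsE[OF two_sets e(2) a(1)] by blast
      then show ?thesis using Kout[OF a(2)] e a by blast
    qed
    moreover have "K - {z} \<subseteq> \<Union>NK" using N KB unfolding NK_def covers_exactly_def by blast
    \<comment> \<open>Parity decides between the two: \<open>K - {z}\<close> has odd size, so
      \<open>w\<close> must be covered.\<close>
    ultimately have "\<Union>NK = K - {z} \<or> \<Union>NK = insert w (K - {z})" by blast
    moreover have "covers_exactly EK (\<Union>NK) NK"
      using N unfolding covers_exactly_def NK_def EK_def pairwise_def by blast
    then have mNK: "matchable EK (\<Union>NK)" unfolding matchable_def by blast
    moreover have "\<not> matchable EK (K - {z})"
    proof
      assume "matchable EK (K - {z})"
      then have "even (card (K - {z}))" using matchable_even[OF twoEK] finK by blast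
      then show False using evenK zK finK
        by (metis card_Suc_Diff1 even_Suc)
    qed
    ultimately show ?thesis using yw(3) unfolding W_def by auto
  qed

  have EK_partner: "\<exists>k\<in>K. k \<in> U \<and> {w, k} \<in> E \<and> matchable E (U - {w, k})"
    if U: "matchable EK U" "w \<in> U" "w \<in> V0" for U w
  proof -
    obtain k where k: "k \<in> U" "{w, k} \<in> EK" "matchable EK (U - {w, k})"
      using matchable_partner[OF twoEK U(1,2)] by metis
    then show ?thesis using U KB matchable_mono[OF k(3) EKE] unfolding EK_def by blast
  qed

  \<comment> \<open>Since \<open>V0\<close> stays linked by allowed edges within
    \<open>V - K\<close>, \<open>kotzig_transitive\<close> applies there and makes this an
    equivalence on \<open>V0\<close>.\<close>
  define rel where "rel = (\<lambda>a b. a = b \<or> \<not> matchable E (V - K - {a, b}))"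
  have rel_sym: "rel a b \<Longrightarrow> rel b a" for a b unfolding rel_def by (auto simp: insert_commute)
  have rel_trans: "rel a c" if abc: "rel a b" "rel b c" "a \<in> V0" "b \<in> V0" "c \<in> V0" for a b c
  proof (rule ccontr)
    assume neg: "\<not> rel a c"
    then have ne: "distinct [a, b, c]" using abc unfolding rel_def by auto
    have sub: "V0 \<subseteq> V - K" using V0_subset KB by blast
    have "(link E (V - K))\<^sup>*\<^sup>* b a"
    proof (rule link_restrict[OF sub])
      fix M e assume "covers_exactly E V M" "e \<in> M"
      then show "e \<subseteq> V - K \<or> e \<inter> (V - K) = {}"
        using Kclosed[of M e] unfolding covers_exactly_def by blast
    qed (use abc in auto)
    then have "matchable E (V - K - {a, b}) \<or> matchable E (V - K - {b, c})"
      using kotzig_transitive[OF two_sets _ _ _ ne] abc sub neg finite_V unfolding rel_def by auto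
    then show False using abc ne unfolding rel_def by auto
  qed

  have ear: "rel w w'" if ww: "matchable EK (insert w (insert w' K))" "w \<in> V0" "w' \<in> V0" for w w'
  proof (rule ccontr)
    assume neg: "\<not> rel w w'"
    obtain k where k: "k \<in> K" "{w, k} \<in> E" "matchable E (insert w (insert w' K) - {w, k})"
      using EK_partner[OF ww(1) _ ww(2)] by auto
    \<comment> \<open>Together the two matchings miss only \<open>w\<close> and \<open>k\<close>,
      which would make the edge \<open>{w, k}\<close> from \<open>V0\<close> to \<open>K\<close>
      allowed.\<close>
    have "matchable E ((insert w (insert w' K) - {w, k}) \<union> (V - K - {w, w'}))"
      using neg KB ww by (intro matchable_Un[OF k(3)]) (auto simp: rel_def)
    moreover have "(insert w (insert w' K) - {w, k}) \<union> (V - K - {w, w'}) = V - {w, k}"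
      using k KB V0_subset ww neg unfolding rel_def by blast
    ultimately show False using no_crossing[OF k(2) ww(2)] k KB by auto
  qed
  have attach: "rel w u" if zu: "z \<in> K" "u \<in> V0" "{z, u} \<in> E" "w \<in> W z" for z u w
  proof (cases "w = u")
    case False
    have w: "w \<in> V0" "matchable EK (insert w (K - {z}))" using zu unfolding W_def by auto
    have "{z, u} \<in> EK" using zu unfolding EK_def by blast
    then have "matchable EK (insert w (insert u K))"
      by (rule matchable_add_edge[OF w(2)]) (use zu False KB w in auto)
    then show ?thesis using ear w zu by blast
  qed (simp add: rel_def)
  have spread: "w' \<in> W z"
    if zz: "z \<in> K" "z' \<in> K" "{z, z'} \<in> E" "w \<in> W z" "w' \<in> W z'" "\<not> rel w w'" for z z' w w'
  proof -
    define U where "U = insert w (insert w' K)"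
    have w: "w \<in> V0" "w' \<in> V0" "w \<noteq> w'" using zz unfolding W_def rel_def by auto
    have "z \<noteq> z'" using zz(3) two_sets unfolding two_sets_def by fastforce
    moreover have K: "w \<notin> K" "w' \<notin> K" using KB w by auto
    ultimately have dist: "distinct [z', z, w, w']" "{z', z, w, w'} \<subseteq> U"
      using zz w unfolding U_def by auto
    have eq: "insert w' (K - {z'}) = U - {z', w}" "insert w (K - {z}) = U - {z, w'}"
      "insert w' (K - {z}) = U - {z, w}"
      using zz w K unfolding U_def by blast+
    have "matchable EK (U - {z', w})" "matchable EK (U - {z, w'})"
      using zz(4,5) unfolding W_def eq[symmetric] by blast+
    \<comment> \<open>By \<open>ear\<close>, \<open>U\<close> has no matching in \<open>EK\<close>.
      This rules out the third outcome, and also the first, since \<open>{z', z}\<close> could be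
      added to it. The second says that \<open>w'\<close> is in \<open>W z\<close>.\<close>
    then have "matchable EK (U - {z', z}) \<or> matchable EK (U - {z, w}) \<or>
        matchable EK (U - {z', z, w, w'}) \<and> matchable EK U"
      using finK dist by (intro matching_exchange[OF twoEK]) (auto simp: U_def)
    moreover have "\<not> matchable EK U" using ear w zz unfolding U_def by blast
    moreover have "\<not> matchable EK (U - {z', z})"
    proof
      assume "matchable EK (U - {z', z})"
      moreover have "{z', z} \<in> EK" using zz unfolding EK_def by (auto simp: insert_commute)
      ultimately have "matchable EK U"
        by (rule matchable_add_edge) (use dist in auto)
      then show False using ear w zz unfolding U_def by blast
    qed
    ultimately show ?thesis using w unfolding W_def by (simp add: eq)
  qed

  \<comment> \<open>Any member of \<open>W v\<close> serves as the deleted vertex; it is adjacent to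
    some \<open>z0\<close> in \<open>K\<close>.\<close>
  obtain x where xW: "x \<in> W v" using Wne vK by blast
  then have xV0: "x \<in> V0" and "matchable EK (insert x (K - {v}))" unfolding W_def by auto
  then obtain z0 where z0: "z0 \<in> K" "{x, z0} \<in> E" using EK_partner by blast
  \<comment> \<open>The property holds at \<open>z0\<close> by \<open>attach\<close>. It passes
    along an edge of \<open>K\<close> because, by \<open>spread\<close>, a new member of
    \<open>W c\<close> is either equivalent to a member of \<open>W b\<close> or itself in
    \<open>W b\<close>.\<close>
  define P where "P = (\<lambda>z. \<forall>w\<in>W z. rel w x)"
  have Pz0: "P z0" using attach[OF z0(1) xV0] z0(2) unfolding P_def by (simp add: insert_commute)
  have WV0: "w \<in> W z \<Longrightarrow> w \<in> V0" for w z unfolding W_def by blast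
  have Pstep: "P c" if bc: "b \<in> K" "c \<in> K" "{b, c} \<in> E" "P b" for b c
    unfolding P_def
  proof
    fix w' assume w': "w' \<in> W c"
    obtain w where w: "w \<in> W b" using Wne bc by blast
    show "rel w' x"
    proof (cases "rel w w'")
      case True
      then show ?thesis
        using rel_trans[of w' w x] rel_sym bc w w' WV0 xV0 unfolding P_def by blast
    next
      case False
      then show ?thesis using spread[of b c w w'] bc w w' unfolding P_def by blast
    qed
  qed
  have Piff: "u \<in> K \<Longrightarrow> P u \<longleftrightarrow> P v" for u
  proof -
    assume "u \<in> K"
    then have "R\<^sup>*\<^sup>* v u" unfolding K_def by blast
    then show "P u \<longleftrightarrow> P v"
    proof (induction rule: rtranclp_induct)
      case (step b c)
      have "b \<in> K" "c \<in> K"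
        using step.hyps rtranclp.rtrancl_into_rtrancl[OF step.hyps] unfolding K_def by auto
      moreover have "{b, c} \<in> E" "{c, b} \<in> E"
        using step.hyps(2) unfolding R_def by (auto simp: insert_commute)
      ultimately show ?case using Pstep step.IH by blast
    qed simp
  qed
  have boundary: "rel u x" if zu: "z \<in> K" "u \<in> V0" "{z, u} \<in> E" for z u
  proof -
    obtain w where w: "w \<in> W z" using Wne zu by blast
    moreover have "P z" using Piff Pz0 zu z0 by blast
    ultimately have "rel w x" unfolding P_def by blast
    then show ?thesis
      using rel_trans[of u w x] rel_sym[OF attach[OF zu w]] zu WV0[OF w] xV0 by blast
  qed
  \<comment> \<open>Followed to its first entry into \<open>K\<close>, or to \<open>y\<close> if it
    never enters, the alternating path from \<open>x\<close> yields a neighbour \<open>u\<close> of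
    \<open>K\<close> that is not equivalent to \<open>x\<close>, against
    \<open>boundary\<close>.\<close>
  have main: "\<not> matchable E (V - {x, y})"
    if y: "y \<in> V" "y \<noteq> x" "y \<in> K \<or> (\<exists>k\<in>K. {y, k} \<in> E)" for y
  proof
    assume "matchable E (V - {x, y})"
    then have "y \<notin> K \<and> matchable E (V - K - {x, y}) \<or>
      (\<exists>u\<in>V - K. u \<noteq> x \<and> (\<exists>k\<in>K. {u, k} \<in> E) \<and> matchable E (V - K - {x, u}))"
      using matching_first_entry[OF two_sets finite_V M Kclosed[OF M]] y xV0 V0_subset KB by blast
    then obtain u k where u: "u \<in> V - K" "u \<noteq> x" "k \<in> K" "{k, u} \<in> E"
      "matchable E (V - K - {u, x})"
      using y by (auto simp: insert_commute)
    then have "rel u x" using boundary Kout by blast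
    then show False using u unfolding rel_def by blast
  qed
  show ?thesis
  proof (intro bexI[OF _ xV0] conjI ballI impI)
    show "\<not> matchable E (V - {x, v})" using main[of v] vK v xV0 by blast
    fix d assume "d \<in> V - {x}" "{v, d} \<in> E"
    moreover from this have "{d, v} \<in> E" by (simp add: insert_commute)
    ultimately show "\<not> matchable E (V - {x, d})" using main[of d] vK by blast
  qed
qed

end

section \<open>Translating contraction, components and Gallai-Edmonds sets into matchings\<close>

text \<open>In a perfect matching of the contraction without \<open>x\<close>, the shrunk vertex
  \<open>None\<close> has a partner \<open>Some z\<close>. All other matching edges avoid
  \<open>None\<close> and hence come from edges of \<open>F\<close> outside
  \<open>Y\<close>.\<close>

lemma factor_critical_contract:
  fixes F :: "'a ugraph"
  assumes "\<And>e. e \<in> edges F \<Longrightarrow> e \<subseteq> verts F \<and> card e = 2"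
    and "factor_critical (contract F Y)" "x \<in> verts F - Y" "Y \<inter> verts F \<noteq> {}"
  shows "\<exists>z w. z \<in> verts F - Y \<and> z \<noteq> x \<and> w \<in> Y \<and> {w, z} \<in> edges F \<and>
    matchable (edges F) (verts F - Y - {x, z})"
proof -
  define V' where "V' = contract_map Y ` verts F"
  have V': "V' = insert None (Some ` (verts F - Y))"
    using assms(4) unfolding V'_def contract_map_def by auto
  have verts: "verts (contract F Y) = V'" unfolding contract_def V'_def by simp
  have "Some x \<in> V'" using assms(3) V' by blast
  then obtain N where N: "perfect_matching (delete_vert (contract F Y) (Some x)) N"
    using assms(2) verts unfolding factor_critical_def factorizable_def by blast
  have two: "two_sets (edges (contract F Y))" unfolding two_sets_def contract_def by auto
  have "covers_exactly (edges (contract F Y)) (V' - {Some x}) N"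
    using N unfolding perfect_matching_def matching_def covers_exactly_def delete_vert_def
      induced_def verts by auto
  then obtain p where p: "p \<in> V' - {Some x}" "p \<noteq> None" "{None, p} \<in> edges (contract F Y)"
    "covers_exactly (edges (contract F Y)) (V' - {Some x} - {None, p}) (N - {{None, p}})"
    using covers_exactly_partner[OF two, of _ N None] V' by (metis DiffI empty_iff insertCI insertE option.distinct(1))
  then obtain z where z: "p = Some z" "z \<in> verts F - Y" "z \<noteq> x" using V' by auto
  obtain e where e: "e \<in> edges F" "contract_map Y ` e = {None, Some z}"
    using p(3) z unfolding contract_def by auto
  obtain w where w: "w \<in> e" "contract_map Y w = None" using e(2) by (metis image_iff insertI1)
  then have wY: "w \<in> Y" unfolding contract_map_def by (auto split: if_splits)
  have "Some z \<in> contract_map Y ` e" using e(2) by simp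
  then have "z \<in> e" unfolding contract_map_def by (auto split: if_splits)
  moreover have "z \<noteq> w" using z wY by blast
  moreover obtain a b where "e = {a, b}" using assms(1)[OF e(1)] by (meson card_2_iff)
  ultimately have "e = {w, z}" using w(1) by auto
  then have wz: "{w, z} \<in> edges F" using e(1) by simp

  define N' where "N' = N - {{None, p}}"
  define g :: "'a option set \<Rightarrow> 'a set" where "g = (\<lambda>f. {a. Some a \<in> f})"
  have N': "covers_exactly (edges (contract F Y)) (Some ` (verts F - Y - {x, z})) N'"
  proof -
    have "V' - {Some x} - {None, p} = Some ` (verts F - Y - {x, z})" using V' z by auto
    then show ?thesis using p(4) unfolding N'_def by simp
  qed
  have lift: "g f \<in> edges F" if f: "f \<in> N'" for f
  proof -
    obtain e where e: "e \<in> edges F" "f = contract_map Y ` e"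
      using N' f unfolding covers_exactly_def contract_def by auto
    have "f \<subseteq> Some ` (verts F - Y - {x, z})" using N' f unfolding covers_exactly_def by blast
    then have "None \<notin> f" by blast
    then have "contract_map Y a \<noteq> None" if "a \<in> e" for a using e(2) that by force
    then have "contract_map Y a = Some a" if "a \<in> e" for a
      using that unfolding contract_map_def by meson
    then have "f = Some ` e" unfolding e(2) by (rule image_cong[OF refl])
    then have "g f = e" unfolding g_def by blast
    then show ?thesis using e by simp
  qed
  have "disjnt (g f) (g f')" if "f \<in> N'" "f' \<in> N'" "f \<noteq> f'" for f f'
  proof -
    have "f \<inter> f' = {}" using N' that unfolding covers_exactly_def pairwise_def disjnt_def by metis
    then show ?thesis unfolding g_def disjnt_def by blast
  qed
  then have "pairwise disjnt (g ` N')" unfolding pairwise_def by blast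
  moreover have "\<Union>(g ` N') = verts F - Y - {x, z}"
  proof -
    have "\<Union>(g ` N') = g (\<Union>N')" unfolding g_def by blast
    also have "\<dots> = verts F - Y - {x, z}"
      using N' unfolding g_def covers_exactly_def by auto
    finally show ?thesis .
  qed
  ultimately have "covers_exactly (edges F) (verts F - Y - {x, z}) (g ` N')"
    using lift unfolding covers_exactly_def by blast
  then show ?thesis using z wY wz unfolding matchable_def by blast
qed

lemma perfect_matching_iff: "perfect_matching G M \<longleftrightarrow> covers_exactly (edges G) (verts G) M"
  unfolding perfect_matching_def matching_def covers_exactly_def by blast

lemma adj_allowed_subgraph: "adj (allowed_subgraph G) = link (edges G) (verts G)"
  unfolding adj_def allowed_subgraph_def allowed_edges_def link_def perfect_matching_iff
  by (intro ext) (auto simp: covers_exactly_def)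

text \<open>A perfect matching consists of allowed edges, so the allowed subgraph has all vertices
  of \<open>G\<close>.\<close>

lemma factor_components_verts:
  assumes "factorizable G"
  shows "verts ` factor_components G = (\<lambda>v. {u. (link (edges G) (verts G))\<^sup>*\<^sup>* v u}) ` verts G"
proof -
  let ?A = "allowed_subgraph G"
  obtain M where M: "covers_exactly (edges G) (verts G) M"
    using assms unfolding factorizable_def perfect_matching_iff by blast
  have vA: "verts ?A = verts G"
  proof
    show "verts ?A \<subseteq> verts G"
      unfolding allowed_subgraph_def allowed_edges_def perfect_matching_iff
      by (auto simp: covers_exactly_def)
    have "M \<subseteq> allowed_edges G"
      using M unfolding allowed_edges_def perfect_matching_iff covers_exactly_def by blast
    then show "verts G \<subseteq> verts ?A"
      using M unfolding allowed_subgraph_def covers_exactly_def ugraph.select_convs by blast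
  qed
  have sub: "u \<in> verts G" if "(link (edges G) (verts G))\<^sup>*\<^sup>* v u" "v \<in> verts G" for u v
    using that
  proof (induction rule: rtranclp_induct)
    case (step b c)
    then obtain N where "covers_exactly (edges G) (verts G) N" "{b, c} \<in> N"
      unfolding link_def by blast
    then show ?case unfolding covers_exactly_def by blast
  qed
  have "verts (induced G (verts (induced ?A {u. (adj ?A)\<^sup>*\<^sup>* v u})))
      = {u. (link (edges G) (verts G))\<^sup>*\<^sup>* v u}" if "v \<in> verts G" for v
    using sub that unfolding adj_allowed_subgraph induced_def by (auto simp: vA)
  then show ?thesis
    unfolding factor_components_def elementary_components_def connected_components_def
      image_image vA by (intro image_cong) auto
qed

text \<open>\<open>G\<close> has even order, so every matching of \<open>G - x\<close> misses a
  vertex. A perfect matching of \<open>G\<close> without its edge at \<open>x\<close> misses just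
  one, hence the maximum matchings are those missing exactly one.\<close>

lemma GE_D_delete_vert:
  assumes "finite_graph G" "factorizable G" "x \<in> verts G"
  shows "GE_D (delete_vert G x) = {y \<in> verts G - {x}. matchable (edges G) (verts G - {x, y})}"
proof -
  let ?V = "verts G" and ?E = "edges G" and ?F = "delete_vert G x"
  have fin: "finite ?V" and two: "two_sets ?E" and sub: "\<And>e. e \<in> ?E \<Longrightarrow> e \<subseteq> ?V"
    using assms(1) unfolding finite_graph_def two_sets_def by auto
  have F: "verts ?F = ?V - {x}" unfolding delete_vert_def induced_def by auto
  have match: "matching ?F N \<longleftrightarrow> covers_exactly ?E (\<Union>N) N \<and> \<Union>N \<subseteq> ?V - {x}" for N
    unfolding matching_def covers_exactly_def delete_vert_def induced_def by auto
  have card_match: "card (\<Union>N) = 2 * card N" if "matching ?F N" for N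
    using that card_covers_exactly[OF two] fin unfolding match by (meson finite_Diff finite_subset)
  obtain M where M: "covers_exactly ?E ?V M"
    using assms unfolding factorizable_def perfect_matching_iff by blast
  have cV: "card ?V = 2 * card M" using card_covers_exactly[OF two M fin] .
  have card_delete: "card (?V - {x, y}) + 2 = card ?V" if "y \<in> ?V - {x}" for y
  proof -
    have "card {x, y} \<le> card ?V" "card {x, y} = 2"
      using that assms(3) fin by (auto intro!: card_mono)
    then show ?thesis using that assms(3) card_Diff_subset[of "{x, y}" ?V] by auto
  qed
  show ?thesis
  proof (intro equalityI subsetI)
    fix y assume "y \<in> GE_D ?F"
    then obtain N where y: "y \<in> ?V - {x}" and N: "maximum_matching ?F N" "y \<notin> \<Union>N"
      unfolding GE_D_def F by blast
    obtain x' where x': "x' \<in> ?V" "x' \<noteq> x" "covers_exactly ?E (?V - {x, x'}) (M - {{x, x'}})"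
      using covers_exactly_partner[OF two M assms(3)] by metis
    then have "matching ?F (M - {{x, x'}})" unfolding match covers_exactly_def by blast
    then have "card (M - {{x, x'}}) \<le> card N" "matching ?F N"
      using N unfolding maximum_matching_def by blast+
    moreover have "card (?V - {x, x'}) = 2 * card (M - {{x, x'}})"
      using card_covers_exactly[OF two x'(3)] fin by blast
    ultimately have "card (?V - {x, y}) \<le> card (\<Union>N)"
      using card_match[of N] card_delete[of x'] card_delete[OF y] x' by simp
    moreover have "\<Union>N \<subseteq> ?V - {x, y}" using \<open>matching ?F N\<close> N(2) unfolding match by blast
    ultimately have "\<Union>N = ?V - {x, y}" using fin by (intro card_seteq) auto
    then have "matchable ?E (?V - {x, y})"
      using \<open>matching ?F N\<close> unfolding match matchable_def by metis
    then show "y \<in> {y \<in> ?V - {x}. matchable ?E (?V - {x, y})}" using y by blast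
  next
    fix y assume "y \<in> {y \<in> ?V - {x}. matchable ?E (?V - {x, y})}"
    then obtain N where y: "y \<in> ?V - {x}" and N: "covers_exactly ?E (?V - {x, y}) N"
      unfolding matchable_def by blast
    have UN: "\<Union>N = ?V - {x, y}" using N unfolding covers_exactly_def by blast
    have mN: "matching ?F N" unfolding match UN using N by blast
    have "card N' \<le> card N" if "matching ?F N'" for N'
    proof -
      have "card (\<Union>N') \<le> card (?V - {x})" using that fin unfolding match by (intro card_mono) auto
      then have "2 * card N' < 2 * card M"
        using card_match[OF that] cV card_Diff1_less[OF fin assms(3)] by linarith
      moreover have "2 * card N + 2 = 2 * card M"
        using card_match[OF mN] UN card_delete[OF y] cV by simp
      ultimately show ?thesis by linarith
    qed
    then have "maximum_matching ?F N" using mN unfolding maximum_matching_def by blast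
    then show "y \<in> GE_D ?F" using y UN unfolding GE_D_def F by blast
  qed
qed

lemma GE_C_delete_vert:
  assumes "finite_graph G" "factorizable G" "x \<in> verts G" "v \<in> verts G"
  shows "v \<in> GE_C (delete_vert G x) \<longleftrightarrow> v \<noteq> x \<and> \<not> matchable (edges G) (verts G - {x, v}) \<and>
    (\<forall>d\<in>verts G - {x}. {v, d} \<in> edges G \<longrightarrow> \<not> matchable (edges G) (verts G - {x, d}))"
proof -
  have "verts (delete_vert G x) = verts G - {x}"
    "adj (delete_vert G x) a b \<longleftrightarrow> {a, b} \<in> edges G \<and> a \<in> verts G - {x} \<and> b \<in> verts G - {x}" for a b
    unfolding delete_vert_def induced_def adj_def by auto
  then show ?thesis
    using assms(4) unfolding GE_C_def GE_A_def GE_D_delete_vert[OF assms(1-3)] by auto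
qed

section \<open>The vertex set of the minimum component\<close>

theorem theorem5:
  fixes G G0 :: "'a ugraph"
  assumes "finite_graph G"
    and "factorizable G"
    and "G0 \<in> factor_components G"
    and "\<forall>H\<in>factor_components G. factor_le G G0 H"
  shows "verts G0 = verts G - (\<Union>x\<in>verts G. GE_C (delete_vert G x))"
proof -
  let ?V = "verts G" and ?E = "edges G" and ?U = "verts G0"
  let ?L = "(link ?E ?V)\<^sup>*\<^sup>*"
  have fin: "finite ?V" and two: "two_sets ?E" and sub: "\<And>e. e \<in> ?E \<Longrightarrow> e \<subseteq> ?V"
    using assms(1) unfolding finite_graph_def two_sets_def by auto
  obtain M where M: "covers_exactly ?E ?V M"
    using assms unfolding factorizable_def perfect_matching_iff by blast
  have sym: "?L a b \<Longrightarrow> ?L b a" for a b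
    by (rule sympD[OF symp_rtranclp]) (auto simp: symp_def link_def insert_commute)
  have comp: "\<exists>v\<in>?V. verts H = {u. ?L v u}" if "H \<in> factor_components G" for H
    using factor_components_verts[OF assms(2)] that by blast
  have in_comp: "\<exists>H\<in>factor_components G. verts H = {u. ?L v u}" if "v \<in> ?V" for v
  proof -
    have "{u. ?L v u} \<in> verts ` factor_components G"
      unfolding factor_components_verts[OF assms(2)] using that by blast
    then show ?thesis by auto
  qed
  \<comment> \<open>The ends of an edge in a perfect matching lie in the same factor-connected
    component, and a separating set does not split it.\<close>
  have sep: "e \<subseteq> X \<or> e \<inter> X = {}"
    if X: "separating G X" and N: "covers_exactly ?E ?V N" "e \<in> N" for X N e
  proof (rule ccontr)
    assume "\<not> ?thesis"
    then obtain a where a: "a \<in> e" "a \<in> X" "\<not> e \<subseteq> X" by blast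
    have eE: "e \<in> ?E" using N unfolding covers_exactly_def by blast
    then obtain b where b: "e = {a, b}" using two_setsE[OF two _ a(1)] by blast
    obtain H where H: "H \<in> factor_components G" "verts H = {u. ?L a u}"
      using in_comp[of a] sub[OF eE] a by blast
    have "link ?E ?V a b" using N b unfolding link_def by blast
    then have "a \<in> verts H" "b \<in> verts H" using H by auto
    then have "b \<in> X" using X H(1) a(2) unfolding separating_def by blast
    then show False using a b by blast
  qed
  obtain r where r: "r \<in> ?V" "?U = {u. ?L r u}" using comp[OF assms(3)] by blast
  have sepV0: "separating G ?U"
    unfolding separating_def
  proof (intro conjI ballI)
    show "?U \<subseteq> ?V" using assms(3) unfolding factor_components_def induced_def by auto
    fix H assume "H \<in> factor_components G"
    then obtain h where h: "verts H = {u. ?L h u}" using comp by blast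
    show "verts H \<subseteq> ?U \<or> verts H \<inter> ?U = {}"
      unfolding h r using sym rtranclp_trans[of "link ?E ?V"] by blast
  qed
  interpret factor_component_core ?E ?V ?U
  proof
    show "?U \<subseteq> ?V" using sepV0 unfolding separating_def by blast
    show "matchable ?E ?V" using M unfolding matchable_def by blast
    show "?L a b" if "a \<in> ?U" "b \<in> ?U" for a b
      using that sym[of r a] unfolding r by (auto dest: rtranclp_trans)
    show "\<exists>z w. z \<in> ?V - ?U \<and> z \<noteq> x \<and> w \<in> ?U \<and> {w, z} \<in> ?E \<and>
        matchable ?E (?V - ?U - {x, z})" if x: "x \<in> ?V - ?U" for x
    proof -
      obtain H where H: "H \<in> factor_components G" "verts H = {u. ?L x u}"
        using in_comp x by blast
      then obtain X where X: "separating G X" "?U \<union> verts H \<subseteq> X"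
        "factor_critical (contract (induced G X) ?U)"
        using assms(4) unfolding factor_le_def by blast
      have xX: "x \<in> X" using X H by auto
      have XV: "X \<subseteq> ?V" using X unfolding separating_def by blast
      have vX: "verts (induced G X) = X" using XV unfolding induced_def by auto
      have eX: "edges (induced G X) = {e \<in> ?E. e \<subseteq> X}" unfolding induced_def by simp
      have "r \<in> ?U \<inter> X" using r X(2) by auto
      then obtain z w where zw: "z \<in> X - ?U" "z \<noteq> x" "w \<in> ?U" "{w, z} \<in> ?E"
        "matchable {e \<in> ?E. e \<subseteq> X} (X - ?U - {x, z})"
        using factor_critical_contract[OF _ X(3), of x] x xX X(2) two
        unfolding vX eX two_sets_def by blast
      \<comment> \<open>Factor-criticality only concerns \<open>X\<close>; as \<open>X\<close> is
        separating, \<open>M\<close> matches the rest of the graph within itself.\<close>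
      have "covers_exactly ?E (?V - X) {e \<in> M. e \<subseteq> ?V - X}"
      proof (rule covers_exactly_restrict[OF M])
        fix e assume "e \<in> M"
        then show "e \<subseteq> ?V - X \<or> e \<inter> (?V - X) = {}"
          using sep[OF X(1) M, of e] M unfolding covers_exactly_def by blast
      qed blast
      then have "matchable ?E (?V - X)" unfolding matchable_def by blast
      moreover have "matchable ?E (X - ?U - {x, z})" by (rule matchable_mono[OF zw(5)]) blast
      ultimately have "matchable ?E ((?V - X) \<union> (X - ?U - {x, z}))" by (intro matchable_Un) auto
      moreover have "(?V - X) \<union> (X - ?U - {x, z}) = ?V - ?U - {x, z}"
        using XV X(2) xX zw by blast
      ultimately show ?thesis using zw XV by (metis DiffD1 DiffD2 DiffI subsetD)
    qed
  qed (use fin two sub sep[OF sepV0] in blast)+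
  have "v \<in> ?U \<longleftrightarrow> (\<forall>x\<in>?V. v \<notin> GE_C (delete_vert G x))" if v: "v \<in> ?V" for v
  proof
    assume "v \<in> ?U"
    then show "\<forall>x\<in>?V. v \<notin> GE_C (delete_vert G x)"
      using V0_not_GE_C GE_C_delete_vert[OF assms(1,2) _ v] by blast
  next
    assume h: "\<forall>x\<in>?V. v \<notin> GE_C (delete_vert G x)"
    show "v \<in> ?U"
      using outside_GE_C[of v] GE_C_delete_vert[OF assms(1,2) _ v] h V0_subset v by blast
  qed
  then show ?thesis using V0_subset by blast
qed

end
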